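(* Let $S$ be a totally ordered idempotent semifield, let $V$ be a free $S$-module of finite rank $n$ with basis $e_1,\dots,e_n$, and let $w\in\bigwedge^dV$ be a tropical Plücker vector. Then \[ (L_w)^\perp=L_{\star w}, \] and hence $L_w^{\perp\perp}=L_w$.
   Context: An idempotent semifield $S$ is a (commutative) semiring satisfying all axioms of a field except the existence of additive inverses, and such that $s+s=s$ for all $s\in S$; its additive and multiplicative identities are $0$ and $1$. It is totally ordered if the order $a\le b\Leftrightarrow a+b=b$ is total, i.e. $a+b\in\{a,b\}$ for all $a,b$. Write $[n]=\{1,\dots,n\}$, $I+j=I\cup\{j\}$, $I-j=I\smallsetminus\{j\}$, $I^c=[n]\smallsetminus I$, $V^\vee=\mathrm{Hom}_S(V,S)$ with dual basis $x_1,\dots,x_n$, and identify $V^{\vee\vee}\cong V$. For a finite rank free module $F$ with basis $f_1,\dots,f_n$, the tropical Grassmann algebra is $\bigwedge F:=\mathrm{Sym}\,F/\langle f_i^2\sim 0\rangle_{i=1}^n$ (quotient by the generated $S$-algebra congruence), graded, with commutative product $\wedge$; $\bigwedge^dF$ is free with basis $f_I=f_{i_1}\wedge\cdots\wedge f_{i_d}$, $I\in\binom{[n]}{d}$. This is applied to $V$ with basis $e_i$ and to $V^\vee$ with basis $x_i$. A nonzero $w=\sum_I w_If_I\in\bigwedge^dF$ is a tropical Plücker vector if for all $A\in\binom{[n]}{d+1}$, $B\in\binom{[n]}{d-1}$ and every $p\in A\smallsetminus B$, $\sum_{i\in A\smallsetminus B}w_{A-i}w_{B+i}=\sum_{i\in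 A\smallsetminus B,\, i\ne p}w_{A-i}w_{B+i}$. For a linear map $\varphi:F\to M$, $\mathrm{tropker}(\varphi)\subset F$ is the submodule of all $\sum_iv_if_i$ with $\varphi(\sum_iv_if_i)=\varphi(\sum_{i\ne j}v_if_i)$ for each $j\in[n]$. For $w\in\bigwedge^dF$, $L_w:=\mathrm{tropker}(-\wedge w:F\to\bigwedge^{d+1}F)\subset F$. The tropical Hodge star sends $w=\sum_Iw_Ie_I\in\bigwedge^dV$ to $\star w=\sum_Iw_Ix_{I^c}\in\bigwedge^{n-d}V^\vee$ (it comes from the pairing $\bigwedge^dV\times\bigwedge^{n-d}V\to\bigwedge^nV\cong S$ with generator $e_1\wedge\cdots\wedge e_n$). Thus $L_{\star w}\subset V^\vee$. The orthogonal dual of a submodule $L\subset V$ is $L^\perp=\bigcap_{\alpha\in L}\mathrm{tropker}(\alpha)\subset V^\vee$, where $\alpha\in V\cong V^{\vee\vee}$ is regarded as a linear map $V^\vee\to S$; for a submodule of $V^\vee$ the orthogonal dual is the submodule of $V$ defined in the same way. *)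

theory Defs
  imports "HOL-Library.Poly_Mapping" "HOL-Library.Function_Algebras"
begin

section \<open>Totally ordered idempotent semifields\<close>

class idempotent_semifield = comm_semiring_1 +
  assumes ex_mult_inverse: "a \<noteq> 0 \<Longrightarrow> \<exists>b. a * b = 1"
    and add_idempotent: "a + a = a"

class totally_ordered_idempotent_semifield = idempotent_semifield +
  assumes add_selects: "a + b = a \<or> a + b = b"


section \<open>Free modules of finite rank and their duals\<close>

text \<open>The library's locale \<open>module\<close> is not applicable, as it requires additive inverses.\<close>

locale semimodule =
  fixes scale :: "'a::comm_semiring_1 \<Rightarrow> 'v::comm_monoid_add \<Rightarrow> 'v"
  assumes scale_add_right: "scale a (u + v) = scale a u + scale a v"
    and scale_add_left: "scale (a + b) v = scale a v + scale b v"
    and scale_scale: "scale a (scale b v) = scale (a * b) v"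
    and scale_one: "scale 1 v = v"
    and scale_zero_left: "scale 0 v = 0"
    and scale_zero_right: "scale a 0 = 0"

definition lincomb ::
  "('a \<Rightarrow> 'f \<Rightarrow> 'f::comm_monoid_add) \<Rightarrow> (nat \<Rightarrow> 'f) \<Rightarrow> nat set \<Rightarrow> (nat \<Rightarrow> 'a) \<Rightarrow> 'f"
  where "lincomb sm f J c = (\<Sum>i\<in>J. sm (c i) (f i))"

text \<open>
  \<open>f 1, \<dots>, f n\<close> is a basis of \<open>F\<close>. Coefficient families are indexed by all natural
  numbers and normalised to vanish outside \<open>{1..n}\<close>, which makes uniqueness meaningful.
\<close>

definition is_basis ::
  "('a::zero \<Rightarrow> 'f \<Rightarrow> 'f::comm_monoid_add) \<Rightarrow> 'f set \<Rightarrow> nat \<Rightarrow> (nat \<Rightarrow> 'f) \<Rightarrow> bool"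
  where "is_basis sm F n f \<longleftrightarrow> (\<forall>i\<in>{1..n}. f i \<in> F) \<and>
    (\<forall>u\<in>F. \<exists>!c. (\<forall>i. i \<notin> {1..n} \<longrightarrow> c i = 0) \<and> u = lincomb sm f {1..n} c)"

definition coords ::
  "('a::zero \<Rightarrow> 'f \<Rightarrow> 'f::comm_monoid_add) \<Rightarrow> nat \<Rightarrow> (nat \<Rightarrow> 'f) \<Rightarrow> 'f \<Rightarrow> nat \<Rightarrow> 'a"
  where "coords sm n f u =
    (THE c. (\<forall>i. i \<notin> {1..n} \<longrightarrow> c i = 0) \<and> u = lincomb sm f {1..n} c)"

locale free_semimodule = semimodule scale
  for scale :: "'a::comm_semiring_1 \<Rightarrow> 'v::comm_monoid_add \<Rightarrow> 'v" +
  fixes n :: nat and e :: "nat \<Rightarrow> 'v"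
  assumes basis: "is_basis scale UNIV n e"

definition dual_space ::
  "('a \<Rightarrow> 'v \<Rightarrow> 'v) \<Rightarrow> ('v::comm_monoid_add \<Rightarrow> 'a::comm_semiring_1) set"
  where "dual_space scale =
    {\<xi>. (\<forall>u v. \<xi> (u + v) = \<xi> u + \<xi> v) \<and> (\<forall>a v. \<xi> (scale a v) = a * \<xi> v)}"

definition dual_scale :: "'a::times \<Rightarrow> ('v \<Rightarrow> 'a) \<Rightarrow> ('v \<Rightarrow> 'a)"
  where "dual_scale a \<xi> = (\<lambda>v. a * \<xi> v)"

definition dual_basis ::
  "('a::zero \<Rightarrow> 'v \<Rightarrow> 'v::comm_monoid_add) \<Rightarrow> nat \<Rightarrow> (nat \<Rightarrow> 'v) \<Rightarrow> nat \<Rightarrow> ('v \<Rightarrow> 'a)"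
  where "dual_basis scale n e i = (\<lambda>v. coords scale n e v i)"


section \<open>The tropical Grassmann algebra\<close>

text \<open>
  For \<open>F\<close> free with basis \<open>f 1, \<dots>, f n\<close>, \<open>Sym F\<close> is the polynomial semiring in the variables
  \<open>X 1, \<dots>, X n\<close>, where \<open>X i\<close> stands for \<open>f i\<close>; an exponent vector is a finitely supported
  function from variable indices to exponents. The same polynomials serve for \<open>V\<close>
  (\<open>X i\<close> stands for \<open>e i\<close>) and for its dual (\<open>X i\<close> stands for \<open>x i\<close>).
\<close>

type_synonym 'a sympoly = "(nat \<Rightarrow>\<^sub>0 nat) \<Rightarrow>\<^sub>0 'a"

definition Const :: "'a::zero \<Rightarrow> 'a sympoly"
  where "Const a = Poly_Mapping.single 0 a"

definition X :: "nat \<Rightarrow> 'a::comm_semiring_1 sympoly"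
  where "X i = Poly_Mapping.single (Poly_Mapping.single i 1) 1"

definition Sym :: "nat \<Rightarrow> 'a::comm_semiring_1 sympoly set"
  where "Sym n = {p. \<forall>m\<in>Poly_Mapping.keys p. Poly_Mapping.keys m \<subseteq> {1..n}}"

definition Sym_deg :: "nat \<Rightarrow> nat \<Rightarrow> 'a::comm_semiring_1 sympoly set"
  where "Sym_deg n d =
    {p \<in> Sym n. \<forall>m\<in>Poly_Mapping.keys p. (\<Sum>i\<in>Poly_Mapping.keys m. Poly_Mapping.lookup m i) = d}"

text \<open>The semiring congruence on \<open>Sym n\<close> generated by \<open>(X i)\<^sup>2 \<sim> 0\<close>. Compatibility with
  scalars is the case of \<open>mult\<close> in which one factor is a constant.\<close>

inductive_set gcong :: "nat \<Rightarrow> ('a::comm_semiring_1 sympoly \<times> 'a sympoly) set" for n :: nat where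
  square: "i \<in> {1..n} \<Longrightarrow> (X i ^ 2, 0) \<in> gcong n"
| refl: "p \<in> Sym n \<Longrightarrow> (p, p) \<in> gcong n"
| sym: "(p, q) \<in> gcong n \<Longrightarrow> (q, p) \<in> gcong n"
| trans: "(p, q) \<in> gcong n \<Longrightarrow> (q, r) \<in> gcong n \<Longrightarrow> (p, r) \<in> gcong n"
| add: "(p, q) \<in> gcong n \<Longrightarrow> (p', q') \<in> gcong n \<Longrightarrow> (p + p', q + q') \<in> gcong n"
| mult: "(p, q) \<in> gcong n \<Longrightarrow> (p', q') \<in> gcong n \<Longrightarrow> (p * p', q * q') \<in> gcong n"

definition gclass :: "nat \<Rightarrow> 'a::comm_semiring_1 sympoly \<Rightarrow> 'a sympoly set"
  where "gclass n p = gcong n `` {p}"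

definition grassmann_deg :: "nat \<Rightarrow> nat \<Rightarrow> 'a::comm_semiring_1 sympoly set set"
  where "grassmann_deg n d = Sym_deg n d // gcong n"

definition wedge ::
  "nat \<Rightarrow> 'a::comm_semiring_1 sympoly set \<Rightarrow> 'a sympoly set \<Rightarrow> 'a sympoly set"
  where "wedge n P Q = (\<Union>p\<in>P. \<Union>q\<in>Q. gclass n (p * q))"

definition subsets_card :: "nat \<Rightarrow> nat \<Rightarrow> nat set set"
  where "subsets_card n d = {I. I \<subseteq> {1..n} \<and> card I = d}"

definition gcomb :: "nat \<Rightarrow> nat \<Rightarrow> (nat set \<Rightarrow> 'a::comm_semiring_1) \<Rightarrow> 'a sympoly set"
  where "gcomb n d c = gclass n (\<Sum>I\<in>subsets_card n d. Const (c I) * (\<Prod>i\<in>I. X i))"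

text \<open>Coefficient families on \<open>d\<close>-subsets are well defined by \<open>grassmann_deg_free\<close> below.\<close>

definition gcoeff ::
  "nat \<Rightarrow> nat \<Rightarrow> 'a::comm_semiring_1 sympoly set \<Rightarrow> nat set \<Rightarrow> 'a"
  where "gcoeff n d w =
    (THE c. (\<forall>I. I \<notin> subsets_card n d \<longrightarrow> c I = 0) \<and> w = gcomb n d c)"

text \<open>Writing \<open>card B + 1 = d\<close> rather than \<open>card B = d - 1\<close> leaves no \<open>B\<close> when \<open>d = 0\<close>.\<close>

definition plucker_vector :: "nat \<Rightarrow> nat \<Rightarrow> 'a::comm_semiring_1 sympoly set \<Rightarrow> bool"
  where "plucker_vector n d w \<longleftrightarrow>
    w \<in> grassmann_deg n d \<and> w \<noteq> gclass n 0 \<and>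
    (\<forall>A B p. A \<subseteq> {1..n} \<and> card A = d + 1 \<and> B \<subseteq> {1..n} \<and> card B + 1 = d \<and> p \<in> A - B \<longrightarrow>
      (\<Sum>i\<in>A - B. gcoeff n d w (A - {i}) * gcoeff n d w (insert i B)) =
      (\<Sum>i\<in>A - B - {p}. gcoeff n d w (A - {i}) * gcoeff n d w (insert i B)))"

definition hodge_star ::
  "nat \<Rightarrow> nat \<Rightarrow> 'a::comm_semiring_1 sympoly set \<Rightarrow> 'a sympoly set"
  where "hodge_star n d w =
    gclass n (\<Sum>I\<in>subsets_card n d. Const (gcoeff n d w I) * (\<Prod>i\<in>{1..n} - I. X i))"


section \<open>Tropical kernels, the modules \<open>L\<^sub>w\<close> and orthogonal duals\<close>

definition tropker ::
  "('a \<Rightarrow> 'f \<Rightarrow> 'f::comm_monoid_add) \<Rightarrow> nat \<Rightarrow> (nat \<Rightarrow> 'f) \<Rightarrow> ('f \<Rightarrow> 'm) \<Rightarrow> 'f set"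
  where "tropker sm n f \<phi> =
    {lincomb sm f {1..n} v | v.
      \<forall>j\<in>{1..n}. \<phi> (lincomb sm f {1..n} v) = \<phi> (lincomb sm f ({1..n} - {j}) v)}"

text \<open>The inclusion of \<open>F\<close> as the degree 1 part of its Grassmann algebra.\<close>

definition gincl ::
  "('a::comm_semiring_1 \<Rightarrow> 'f \<Rightarrow> 'f::comm_monoid_add) \<Rightarrow> nat \<Rightarrow> (nat \<Rightarrow> 'f) \<Rightarrow> 'f \<Rightarrow> 'a sympoly set"
  where "gincl sm n f u = gclass n (\<Sum>i\<in>{1..n}. Const (coords sm n f u i) * X i)"

definition L_mod ::
  "('a::comm_semiring_1 \<Rightarrow> 'f \<Rightarrow> 'f::comm_monoid_add) \<Rightarrow> nat \<Rightarrow> (nat \<Rightarrow> 'f) \<Rightarrow>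
    'a sympoly set \<Rightarrow> 'f set"
  where "L_mod sm n f w = tropker sm n f (\<lambda>u. wedge n (gincl sm n f u) w)"

text \<open>
  \<open>orth\<close> takes subsets of \<open>V\<close> to subsets of the dual, where \<open>\<alpha>\<close> in \<open>V\<close> acts on the dual by
  evaluation; \<open>orth_dual\<close> goes in the opposite direction.
\<close>

definition orth ::
  "('a::comm_semiring_1 \<Rightarrow> 'v \<Rightarrow> 'v::comm_monoid_add) \<Rightarrow> nat \<Rightarrow> (nat \<Rightarrow> 'v) \<Rightarrow>
    'v set \<Rightarrow> ('v \<Rightarrow> 'a) set"
  where "orth scale n e L =
    (\<Inter>\<alpha>\<in>L. tropker dual_scale n (dual_basis scale n e) (\<lambda>\<xi>. \<xi> \<alpha>))"

definition orth_dual ::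
  "('a::comm_semiring_1 \<Rightarrow> 'v \<Rightarrow> 'v::comm_monoid_add) \<Rightarrow> nat \<Rightarrow> (nat \<Rightarrow> 'v) \<Rightarrow>
    ('v \<Rightarrow> 'a) set \<Rightarrow> 'v set"
  where "orth_dual scale n e M = (\<Inter>\<xi>\<in>M. tropker scale n e \<xi>)"


section \<open>The definitions describe the intended objects\<close>

lemma Sym_add: "p \<in> Sym n \<Longrightarrow> q \<in> Sym n \<Longrightarrow> p + q \<in> Sym n"
  using keys_add[of p q] by (fastforce simp: Sym_def)

lemma Sym_mult:
  assumes "p \<in> Sym n" "q \<in> Sym n" shows "p * q \<in> Sym n"
proof -
  have "Poly_Mapping.keys m \<subseteq> {1..n}" if "m \<in> Poly_Mapping.keys (p * q)" for m
  proof -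
    from that keys_mult[of p q] obtain k l where
      "m = k + l" "k \<in> Poly_Mapping.keys p" "l \<in> Poly_Mapping.keys q" by auto
    with assms keys_add[of k l] show ?thesis unfolding Sym_def by blast
  qed
  then show ?thesis by (simp add: Sym_def)
qed

lemma Sym_zero: "0 \<in> Sym n" by (simp add: Sym_def)

lemma X_power2: "X i ^ 2 = Poly_Mapping.single (Poly_Mapping.single i 2) 1"
  by (simp add: X_def power2_eq_square mult_single numeral_2_eq_2 flip: single_add)

lemma gcong_Sym: "(p, q) \<in> gcong n \<Longrightarrow> p \<in> Sym n \<and> q \<in> Sym n"
proof (induction rule: gcong.induct)
  case (square i)
  then show ?case by (simp add: X_power2 Sym_def)
qed (auto intro: Sym_add Sym_mult)

lemma equiv_gcong: "equiv (Sym n) (gcong n)"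
  by (intro equivI refl_onI symI transI)
    (auto intro: gcong.refl gcong.sym gcong.trans dest: gcong_Sym)

lemma gclass_eq_iff: "p \<in> Sym n \<Longrightarrow> q \<in> Sym n \<Longrightarrow> gclass n p = gclass n q \<longleftrightarrow> (p, q) \<in> gcong n"
  unfolding gclass_def using equiv_gcong eq_equiv_class_iff by fastforce

lemma wedge_gclass:
  assumes "p \<in> Sym n" "q \<in> Sym n"
  shows "wedge n (gclass n p) (gclass n q) = gclass n (p * q)"
proof -
  have "gclass n (p' * q') = gclass n (p * q)" if "p' \<in> gclass n p" "q' \<in> gclass n q" for p' q'
  proof -
    from that have "(p * q, p' * q') \<in> gcong n" by (auto simp: gclass_def intro: gcong.mult)
    moreover from this have "p * q \<in> Sym n" "p' * q' \<in> Sym n" by (auto dest: gcong_Sym)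
    ultimately show ?thesis by (simp add: gclass_eq_iff gcong.sym)
  qed
  moreover have "p \<in> gclass n p" "q \<in> gclass n q"
    using assms by (auto simp: gclass_def intro: gcong.refl)
  ultimately show ?thesis unfolding wedge_def by blast
qed

text \<open>Square-free coefficients are invariants of congruence classes.\<close>

lemma gcong_lookup:
  assumes "(p, q) \<in> gcong n" "\<And>i. Poly_Mapping.lookup m i \<le> 1"
  shows "Poly_Mapping.lookup p m = Poly_Mapping.lookup q m"
  using assms
proof (induction arbitrary: m rule: gcong.induct)
  case (square i)
  have "Poly_Mapping.single i 2 \<noteq> m" using square(2)[of i] by auto
  then show ?case by (simp add: X_power2 lookup_single_not_eq)
next
  case (mult p q p' q')
  have *: "Poly_Mapping.lookup k i \<le> 1" "Poly_Mapping.lookup l i \<le> 1" if "m = k + l" for k l i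
    using mult.prems[of i] that by (auto simp: lookup_add)
  have **: "(Poly_Mapping.lookup p' l when m = k + l) = (Poly_Mapping.lookup q' l when m = k + l)"
    for k l using mult.IH(2) *(2) by (cases "m = k + l") auto
  have "Poly_Mapping.lookup p k * (\<Sum>l. Poly_Mapping.lookup p' l when m = k + l) =
      Poly_Mapping.lookup q k * (\<Sum>l. Poly_Mapping.lookup q' l when m = k + l)" for k
  proof (cases "\<exists>l. m = k + l")
    case True
    then have "Poly_Mapping.lookup p k = Poly_Mapping.lookup q k" using mult.IH(1) * by blast
    then show ?thesis by (simp add: **)
  qed auto
  then show ?case by (simp add: lookup_mult)
qed (auto simp: lookup_add)

definition mono_of :: "nat set \<Rightarrow> nat \<Rightarrow>\<^sub>0 nat"
  where "mono_of I = (\<Sum>i\<in>I. Poly_Mapping.single i 1)"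

lemma lookup_mono_of: "finite I \<Longrightarrow> Poly_Mapping.lookup (mono_of I) i = (if i \<in> I then 1 else 0)"
  by (simp add: mono_of_def lookup_sum lookup_single when_def)

lemma keys_mono_of: "finite I \<Longrightarrow> Poly_Mapping.keys (mono_of I) = I"
  by (auto simp: in_keys_iff lookup_mono_of split: if_splits)

lemma prod_X: "finite I \<Longrightarrow> (\<Prod>i\<in>I. X i) = Poly_Mapping.single (mono_of I) 1"
  by (induction I rule: finite_induct) (auto simp: X_def mono_of_def mult_single)

lemma Const_prod_X:
  "finite I \<Longrightarrow> Const a * (\<Prod>i\<in>I. X i) = Poly_Mapping.single (mono_of I) a"
  by (simp add: prod_X Const_def mult_single)

lemma finite_subsets_card: "finite (subsets_card n d)"
  by (rule finite_subset[of _ "Pow {1..n}"]) (auto simp: subsets_card_def)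

lemma subsets_card_finite: "I \<in> subsets_card n d \<Longrightarrow> finite I"
  by (auto simp: subsets_card_def intro: finite_subset)

lemma mono_of_inject: "finite I \<Longrightarrow> finite J \<Longrightarrow> mono_of I = mono_of J \<longleftrightarrow> I = J"
  using keys_mono_of by metis

definition gpoly :: "nat \<Rightarrow> nat \<Rightarrow> (nat set \<Rightarrow> 'a::comm_semiring_1) \<Rightarrow> 'a sympoly"
  where "gpoly n d c = (\<Sum>I\<in>subsets_card n d. Const (c I) * (\<Prod>i\<in>I. X i))"

lemma lookup_gpoly:
  "Poly_Mapping.lookup (gpoly n d c) m =
    (if \<exists>I\<in>subsets_card n d. m = mono_of I then c (Poly_Mapping.keys m) else 0)"
proof -
  have "Poly_Mapping.lookup (gpoly n d c) m =
      (\<Sum>I\<in>subsets_card n d. c I when mono_of I = m)"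
    unfolding gpoly_def lookup_sum
    by (intro sum.cong HOL.refl) (auto simp: Const_prod_X subsets_card_finite lookup_single)
  also have "\<dots> = (if \<exists>I\<in>subsets_card n d. m = mono_of I then c (Poly_Mapping.keys m) else 0)"
  proof (cases "\<exists>I\<in>subsets_card n d. m = mono_of I")
    case True
    then obtain I where I: "I \<in> subsets_card n d" "m = mono_of I" by blast
    then have "(\<Sum>J\<in>subsets_card n d. c J when mono_of J = m) =
        (\<Sum>J\<in>subsets_card n d. if J = I then c I else 0)"
      by (intro sum.cong HOL.refl) (auto simp: when_def mono_of_inject subsets_card_finite)
    with I show ?thesis
      by (auto simp: finite_subsets_card keys_mono_of subsets_card_finite)
  next
    case False
    then show ?thesis by (auto intro!: sum.neutral simp: when_def)
  qed
  finally show ?thesis .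
qed

lemma gpoly_in_Sym_deg: "gpoly n d c \<in> Sym_deg n d"
  by (auto simp: Sym_deg_def Sym_def in_keys_iff[of _ "gpoly n d c"] lookup_gpoly keys_mono_of
      lookup_mono_of subsets_card_finite split: if_splits) (auto simp: subsets_card_def)

lemma gcong_sum:
  "finite K \<Longrightarrow> (\<And>k. k \<in> K \<Longrightarrow> (f k, g k) \<in> gcong n) \<Longrightarrow> (sum f K, sum g K) \<in> gcong n"
  by (induction K rule: finite_induct) (auto intro: gcong.refl gcong.add Sym_zero)

lemma gcong_gpoly:
  assumes "p \<in> Sym_deg n d"
  shows "(p, gpoly n d (\<lambda>I. Poly_Mapping.lookup p (mono_of I))) \<in> gcong n"
proof -
  let ?K = "Poly_Mapping.keys p"
  let ?sf = "\<lambda>m. \<forall>i. Poly_Mapping.lookup m i \<le> (1::nat)"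
  let ?t = "\<lambda>m. Poly_Mapping.single m (Poly_Mapping.lookup p m)"
  have Sym: "?t m \<in> Sym n" if "m \<in> ?K" for m
    using that assms by (auto simp: Sym_deg_def Sym_def)
  have step: "(?t m, if ?sf m then ?t m else 0) \<in> gcong n" if m: "m \<in> ?K" for m
  proof (cases "?sf m")
    case True
    then show ?thesis using Sym m by (auto intro: gcong.refl)
  next
    case False
    then obtain i where i: "Poly_Mapping.lookup m i \<ge> 2" by (auto simp: not_le Suc_le_eq numeral_2_eq_2)
    define k where "k = m - Poly_Mapping.single i 2"
    have mk: "m = k + Poly_Mapping.single i 2"
      using i by (intro poly_mapping_eqI) (auto simp: k_def lookup_add lookup_minus lookup_single when_def)
    have "i \<in> Poly_Mapping.keys m" using i by (auto simp: in_keys_iff)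
    then have i': "i \<in> {1..n}" using m assms unfolding Sym_deg_def Sym_def by blast
    have "Poly_Mapping.keys k \<subseteq> Poly_Mapping.keys m"
      by (auto simp: mk in_keys_iff lookup_add)
    then have k: "Poly_Mapping.single k (Poly_Mapping.lookup p m) \<in> Sym n"
      using m assms by (auto simp: Sym_deg_def Sym_def)
    have "?t m = Poly_Mapping.single k (Poly_Mapping.lookup p m) * X i ^ 2"
      by (subst mk) (simp add: X_power2 mult_single)
    moreover have "(Poly_Mapping.single k (Poly_Mapping.lookup p m) * X i ^ 2,
        Poly_Mapping.single k (Poly_Mapping.lookup p m) * 0) \<in> gcong n"
      using k i' by (intro gcong.mult gcong.refl gcong.square)
    ultimately show ?thesis using False by auto
  qed
  have lsum: "Poly_Mapping.lookup (\<Sum>m\<in>?K. if Q m then ?t m else 0) l =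
      (if Q l then Poly_Mapping.lookup p l else 0)" for Q l
  proof -
    have "Poly_Mapping.lookup (\<Sum>m\<in>?K. if Q m then ?t m else 0) l =
        (\<Sum>m\<in>?K. if m = l then (if Q l then Poly_Mapping.lookup p l else 0) else 0)"
      unfolding lookup_sum by (intro sum.cong HOL.refl) (auto simp: lookup_single when_def)
    also have "\<dots> = (if Q l then Poly_Mapping.lookup p l else 0)"
      by (auto simp: in_keys_iff)
    finally show ?thesis .
  qed
  have "(\<Sum>m\<in>?K. ?t m) = p"
    using lsum[of "\<lambda>_. True"] by (intro poly_mapping_eqI) simp
  moreover have "(\<Sum>m\<in>?K. if ?sf m then ?t m else 0) =
      gpoly n d (\<lambda>I. Poly_Mapping.lookup p (mono_of I))"
  proof (rule poly_mapping_eqI)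
    fix l
    have "(\<exists>I\<in>subsets_card n d. l = mono_of I)" if "?sf l" "Poly_Mapping.lookup p l \<noteq> 0"
    proof
      have 1: "Poly_Mapping.lookup l i = 1" if "i \<in> Poly_Mapping.keys l" for i
      proof -
        have "Poly_Mapping.lookup l i \<noteq> 0" using that by (simp add: in_keys_iff)
        moreover have "Poly_Mapping.lookup l i \<le> 1" using \<open>?sf l\<close> by blast
        ultimately show ?thesis by linarith
      qed
      show "l = mono_of (Poly_Mapping.keys l)"
        by (intro poly_mapping_eqI) (auto simp: lookup_mono_of 1 in_keys_iff)
      have "l \<in> ?K" using that by (simp add: in_keys_iff)
      with assms have "Poly_Mapping.keys l \<subseteq> {1..n}"
        "(\<Sum>i\<in>Poly_Mapping.keys l. Poly_Mapping.lookup l i) = d"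
        by (auto simp: Sym_deg_def Sym_def)
      then show "Poly_Mapping.keys l \<in> subsets_card n d"
        by (simp add: subsets_card_def 1)
    qed
    moreover have "?sf (mono_of I) \<and> mono_of (Poly_Mapping.keys (mono_of I)) = mono_of I"
      if "I \<in> subsets_card n d" for I
      using that by (auto simp: lookup_mono_of keys_mono_of subsets_card_finite)
    ultimately show "Poly_Mapping.lookup (\<Sum>m\<in>?K. if ?sf m then ?t m else 0) l =
        Poly_Mapping.lookup (gpoly n d (\<lambda>I. Poly_Mapping.lookup p (mono_of I))) l"
      unfolding lsum lookup_gpoly by auto
  qed
  ultimately show ?thesis using gcong_sum[of ?K ?t "\<lambda>m. if ?sf m then ?t m else 0" n] step by simp
qed

lemma gcomb_gpoly: "gcomb n d c = gclass n (gpoly n d c)"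
  by (simp add: gcomb_def gpoly_def)

lemma gcomb_in_grassmann_deg: "gcomb n d c \<in> grassmann_deg n d"
  unfolding gcomb_gpoly gclass_def grassmann_deg_def
  using gpoly_in_Sym_deg by (rule quotientI)

text \<open>The degree \<open>d\<close> part is free on the products of \<open>d\<close> distinct basis elements.\<close>

lemma grassmann_deg_free:
  assumes "w \<in> grassmann_deg n d"
  shows "\<exists>!c. (\<forall>I. I \<notin> subsets_card n d \<longrightarrow> c I = 0) \<and> w = gcomb n d c"
proof -
  from assms obtain p where p: "p \<in> Sym_deg n d" "w = gclass n p"
    by (auto simp: grassmann_deg_def gclass_def elim: quotientE)
  define c where "c I = (if I \<in> subsets_card n d then Poly_Mapping.lookup p (mono_of I) else 0)" for I
  have c: "gpoly n d c = gpoly n d (\<lambda>I. Poly_Mapping.lookup p (mono_of I))"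
    by (simp add: gpoly_def c_def)
  show ?thesis
  proof (rule ex1I[of _ c])
    show "(\<forall>I. I \<notin> subsets_card n d \<longrightarrow> c I = 0) \<and> w = gcomb n d c"
    proof (intro conjI allI impI)
      have "(p, gpoly n d c) \<in> gcong n" unfolding c by (rule gcong_gpoly[OF p(1)])
      moreover from this have "p \<in> Sym n" "gpoly n d c \<in> Sym n" by (auto dest: gcong_Sym)
      ultimately show "w = gcomb n d c" unfolding gcomb_gpoly p(2) by (simp add: gclass_eq_iff)
    qed (simp add: c_def)
  next
    fix b assume b: "(\<forall>I. I \<notin> subsets_card n d \<longrightarrow> b I = 0) \<and> w = gcomb n d b"
    have "p \<in> Sym n" "gpoly n d b \<in> Sym n"
      using p(1) gpoly_in_Sym_deg[of n d b] by (simp_all add: Sym_deg_def)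
    with b p(2) have "(p, gpoly n d b) \<in> gcong n"
      by (simp add: gcomb_gpoly gclass_eq_iff)
    then have *: "Poly_Mapping.lookup p (mono_of I) = b I" if "I \<in> subsets_card n d" for I
      using gcong_lookup[of p "gpoly n d b" n "mono_of I"] that
      by (auto simp: lookup_mono_of keys_mono_of subsets_card_finite lookup_gpoly)
    show "b = c" using b * by (auto simp: c_def fun_eq_iff)
  qed
qed

context free_semimodule
begin

lemma coords_unique:
  assumes "\<And>i. i \<notin> {1..n} \<Longrightarrow> c i = 0" "v = lincomb scale e {1..n} c"
  shows "coords scale n e v = c"
  unfolding coords_def
proof (rule the1_equality)
  show "\<exists>!c. (\<forall>i. i \<notin> {1..n} \<longrightarrow> c i = 0) \<and> v = lincomb scale e {1..n} c"
    using basis unfolding is_basis_def by blast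
  show "(\<forall>i. i \<notin> {1..n} \<longrightarrow> c i = 0) \<and> v = lincomb scale e {1..n} c"
    by (intro conjI allI impI assms)
qed

lemma coords_spec:
  "(\<forall>i. i \<notin> {1..n} \<longrightarrow> coords scale n e v i = 0) \<and>
    v = lincomb scale e {1..n} (coords scale n e v)"
proof -
  have "\<exists>!c. (\<forall>i. i \<notin> {1..n} \<longrightarrow> c i = 0) \<and> v = lincomb scale e {1..n} c"
    using basis unfolding is_basis_def by blast
  from theI'[OF this] show ?thesis unfolding coords_def .
qed

lemma coords_lincomb: "lincomb scale e {1..n} (coords scale n e v) = v"
  by (rule conjunct2[OF coords_spec, symmetric])

lemma coords_outside: "i \<notin> {1..n} \<Longrightarrow> coords scale n e v i = 0"
  by (rule conjunct1[OF coords_spec, rule_format])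

lemma lincomb_add:
  "lincomb scale f J (\<lambda>i. a i + b i) = lincomb scale f J a + lincomb scale f J b"
  by (simp add: lincomb_def scale_add_left sum.distrib)

lemma coords_add: "coords scale n e (u + v) i = coords scale n e u i + coords scale n e v i"
proof -
  let ?c = "\<lambda>i. coords scale n e u i + coords scale n e v i"
  have "?c i = 0" if "i \<notin> {1..n}" for i
    unfolding coords_outside[OF that] by (rule add_0)
  moreover have "u + v = lincomb scale e {1..n} ?c"
    unfolding lincomb_add coords_lincomb by (rule HOL.refl)
  ultimately have "coords scale n e (u + v) = ?c" by (rule coords_unique)
  then show ?thesis by (rule fun_cong)
qed

lemma scale_sum: "scale a (sum f K) = (\<Sum>k\<in>K. scale a (f k))"
  by (induction K rule: infinite_finite_induct) (auto simp: scale_zero_right scale_add_right)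

lemma coords_scale: "coords scale n e (scale a v) i = a * coords scale n e v i"
proof -
  have "coords scale n e (scale a v) = (\<lambda>i. a * coords scale n e v i)"
  proof (rule coords_unique)
    have "scale a (lincomb scale e {1..n} (coords scale n e v)) =
        lincomb scale e {1..n} (\<lambda>i. a * coords scale n e v i)"
      by (simp add: lincomb_def scale_sum scale_scale)
    then show "scale a v = lincomb scale e {1..n} (\<lambda>i. a * coords scale n e v i)"
      by (simp only: coords_lincomb)
  qed (auto simp: coords_outside)
  then show ?thesis by simp
qed

lemma dual_basis_apply:
  assumes "j \<in> {1..n}"
  shows "dual_basis scale n e i (e j) = (if i = j then 1 else 0)"
proof -
  have "lincomb scale e {1..n} (\<lambda>i. if i = j then 1 else 0) = (\<Sum>i\<in>{1..n}. if i = j then e i else 0)"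
    unfolding lincomb_def
    by (intro sum.cong HOL.refl) (simp add: scale_one scale_zero_left)
  then have "coords scale n e (e j) = (\<lambda>i. if i = j then 1 else 0)"
    by (intro coords_unique) (use assms in auto)
  then show ?thesis by (simp add: dual_basis_def)
qed

lemma lincomb_apply:
  "finite J \<Longrightarrow> lincomb dual_scale x J c v = (\<Sum>i\<in>J. c i * x i v)"
  unfolding lincomb_def by (induction J rule: finite_induct) (auto simp: dual_scale_def)

lemma dual_space_sum:
  assumes "\<xi> \<in> dual_space scale" "finite K"
  shows "\<xi> (\<Sum>i\<in>K. scale (c i) (f i)) = (\<Sum>i\<in>K. c i * \<xi> (f i))"
proof -
  have "\<xi> (scale 0 0) = 0 * \<xi> 0" using assms(1) unfolding dual_space_def by blast
  then have "\<xi> 0 = 0" by (simp add: scale_zero_right)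
  with assms(2,1) show ?thesis by (induction K rule: finite_induct) (auto simp: dual_space_def)
qed

lemma dual_basis_is_basis:
  "is_basis dual_scale (dual_space scale) n (dual_basis scale n e)"
  unfolding is_basis_def
proof (intro conjI ballI)
  fix i show "dual_basis scale n e i \<in> dual_space scale"
    by (simp add: dual_space_def dual_basis_def coords_add coords_scale)
next
  fix \<xi> assume \<xi>: "\<xi> \<in> dual_space scale"
  define b where "b i = (if i \<in> {1..n} then \<xi> (e i) else 0)" for i
  show "\<exists>!c. (\<forall>i. i \<notin> {1..n} \<longrightarrow> c i = 0) \<and>
      \<xi> = lincomb dual_scale (dual_basis scale n e) {1..n} c"
  proof (rule ex1I[of _ b])
    have "\<xi> v = lincomb dual_scale (dual_basis scale n e) {1..n} b v" for v
    proof -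
      have "\<xi> v = \<xi> (lincomb scale e {1..n} (coords scale n e v))"
        by (simp only: coords_lincomb)
      also have "\<dots> = (\<Sum>i\<in>{1..n}. coords scale n e v i * \<xi> (e i))"
        unfolding lincomb_def using \<xi> by (simp add: dual_space_sum)
      also have "\<dots> = lincomb dual_scale (dual_basis scale n e) {1..n} b v"
        unfolding lincomb_apply[OF finite_atLeastAtMost]
        by (intro sum.cong HOL.refl) (simp add: b_def dual_basis_def mult.commute)
      finally show ?thesis .
    qed
    then have "\<xi> = lincomb dual_scale (dual_basis scale n e) {1..n} b" by (rule ext)
    moreover have "\<forall>i. i \<notin> {1..n} \<longrightarrow> b i = 0" by (simp add: b_def)
    ultimately show "(\<forall>i. i \<notin> {1..n} \<longrightarrow> b i = 0) \<and>
        \<xi> = lincomb dual_scale (dual_basis scale n e) {1..n} b" by blast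
  next
    fix c assume c: "(\<forall>i. i \<notin> {1..n} \<longrightarrow> c i = 0) \<and>
        \<xi> = lincomb dual_scale (dual_basis scale n e) {1..n} c"
    have "\<xi> (e j) = c j" if j: "j \<in> {1..n}" for j
    proof -
      have "\<xi> (e j) = (\<Sum>i\<in>{1..n}. c i * dual_basis scale n e i (e j))"
        by (subst conjunct2[OF c]) (simp only: lincomb_apply finite_atLeastAtMost)
      also have "\<dots> = (\<Sum>i\<in>{1..n}. if i = j then c i else 0)"
        using j by (intro sum.cong HOL.refl) (simp add: dual_basis_apply)
      finally show ?thesis using j by simp
    qed
    then show "c = b" using conjunct1[OF c] by (intro ext) (simp add: b_def)
  qed
qed

end

end

theory Submission
  imports Defs
begin

text \<open>
  In coordinates, both \<open>L\<^sub>w\<close> and the orthogonal dual are described by one relation between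
  vectors: \<open>u\<close> and \<open>v\<close> are tropically orthogonal if the maximum in \<open>\<Sum>i. u i * v i\<close> is attained
  at least twice or is \<open>0\<close>. Let \<open>c\<close> be the coefficient family of \<open>w\<close>. The coefficients of \<open>v \<and> w\<close>
  are the pairings of \<open>v\<close> with the vectors \<open>i \<mapsto> c (J - {i})\<close>, the valuated circuits of \<open>w\<close>, so
  \<open>L\<^sub>w\<close> consists of the vectors orthogonal to all circuits (\<open>L_mod_iff\<close>). The Hodge star
  complements index sets and thereby exchanges circuits with the cocircuits
  \<open>i \<mapsto> c (insert i B)\<close> (\<open>circuits_of_hodge_star\<close>), so \<open>L\<close> of the Hodge star of \<open>w\<close> consists of the
  vectors orthogonal to all cocircuits.

  By the Pluecker relations circuits are orthogonal to cocircuits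
  (\<open>plucker_cocircuit_circuit_orthogonal\<close>). Hence cocircuits lie in \<open>L\<^sub>w\<close>, and whatever is
  orthogonal to \<open>L\<^sub>w\<close> is orthogonal to all cocircuits; this is one inclusion of the first
  equation, and the same argument with circuits is one inclusion of the second. The remaining
  inclusions both say that a vector orthogonal to all circuits is orthogonal to each vector
  orthogonal to all cocircuits. This is \<open>orthogonal_of_circuits_cocircuits\<close>, a valuated form
  of the fact that a circuit and a cocircuit of a matroid never meet in exactly one element; it
  follows from exchanging elements in a base of maximal weight.
\<close>

section \<open>Order and cancellation in totally ordered idempotent semifields\<close>

text \<open>The order underlying an idempotent addition, for which the sum is the maximum.\<close>

definition trop_le :: "'a::idempotent_semifield \<Rightarrow> 'a \<Rightarrow> bool"
  where "trop_le a b \<longleftrightarrow> a + b = b"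

lemma trop_le_trans: "trop_le a b \<Longrightarrow> trop_le b c \<Longrightarrow> trop_le a c"
  unfolding trop_le_def by (metis add.assoc)

lemma trop_le_zero_right: "trop_le a 0 \<longleftrightarrow> a = 0"
  by (simp add: trop_le_def)

lemma trop_le_mult_left: "trop_le a b \<Longrightarrow> trop_le (z * a) (z * b)"
  unfolding trop_le_def by (metis distrib_left)

lemma semifield_mult_eq_zero_iff:
  fixes a b :: "'a::idempotent_semifield"
  shows "a * b = 0 \<longleftrightarrow> a = 0 \<or> b = 0"
proof
  assume ab: "a * b = 0"
  show "a = 0 \<or> b = 0"
  proof (rule disjCI)
    assume "b \<noteq> 0"
    then obtain z where "b * z = 1" using ex_mult_inverse by blast
    then have "a = a * b * z" by (simp add: mult.assoc)
    then show "a = 0" by (simp add: ab)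
  qed
qed auto

lemma semifield_prod_nonzero:
  fixes f :: "'i \<Rightarrow> 'a::idempotent_semifield"
  assumes "\<And>i. i \<in> K \<Longrightarrow> f i \<noteq> 0"
  shows "prod f K \<noteq> 0"
proof -
  have "(1::'a) \<noteq> 0" by simp
  then show ?thesis using assms
    by (induction K rule: infinite_finite_induct) (auto simp: semifield_mult_eq_zero_iff)
qed

lemma trop_le_mult_left_cancel:
  assumes "z \<noteq> 0" "trop_le (z * a) (z * b)"
  shows "trop_le a b"
proof -
  obtain y where "z * y = 1" using ex_mult_inverse[OF assms(1)] by blast
  then have "y * (z * x) = x" for x by (metis mult.assoc mult.commute mult_1_left)
  with trop_le_mult_left[OF assms(2), of y] show ?thesis by simp
qed

lemma trop_le_sum:
  assumes "finite K" "k \<in> K"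
  shows "trop_le (f k) (sum f K)"
  unfolding trop_le_def sum.remove[OF assms]
  by (simp add: add_idempotent flip: add.assoc)

lemma sum_selects:
  fixes f :: "'i \<Rightarrow> 'a::totally_ordered_idempotent_semifield"
  assumes "finite K" "K \<noteq> {}"
  shows "\<exists>m\<in>K. sum f K = f m"
  using assms
proof (induction K rule: finite_ne_induct)
  case (insert x K)
  then show ?case using add_selects[of "f x" "sum f K"] by auto
qed simp


section \<open>Tropical orthogonality of coordinate vectors\<close>

definition trop_orthogonal ::
  "nat \<Rightarrow> (nat \<Rightarrow> 'a::comm_semiring_1) \<Rightarrow> (nat \<Rightarrow> 'a) \<Rightarrow> bool"
  where "trop_orthogonal n u v \<longleftrightarrow>
    (\<forall>k\<in>{1..n}. (\<Sum>i\<in>{1..n}. u i * v i) = (\<Sum>i\<in>{1..n} - {k}. u i * v i))"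

lemma trop_orthogonal_commute: "trop_orthogonal n u v \<longleftrightarrow> trop_orthogonal n v u"
  by (simp add: trop_orthogonal_def mult.commute)

lemma trop_orthogonal_cong:
  assumes "\<And>i. i \<in> {1..n} \<Longrightarrow> u i = u' i" "\<And>i. i \<in> {1..n} \<Longrightarrow> v i = v' i"
  shows "trop_orthogonal n u v \<longleftrightarrow> trop_orthogonal n u' v'"
proof -
  have "(\<Sum>i\<in>K. u i * v i) = (\<Sum>i\<in>K. u' i * v' i)" if "K \<subseteq> {1..n}" for K
    using that assms by (intro sum.cong) auto
  then show ?thesis unfolding trop_orthogonal_def by simp
qed

text \<open>
  Over a totally ordered semifield a sum is one of its terms, so the sum survives the omission
  of a nonzero term exactly when that term is dominated by another one: the maximum is
  attained at least twice.
\<close>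

lemma trop_orthogonal_iff:
  fixes u v :: "nat \<Rightarrow> 'a::totally_ordered_idempotent_semifield"
  shows "trop_orthogonal n u v \<longleftrightarrow>
    (\<forall>k\<in>{1..n}. u k * v k \<noteq> 0 \<longrightarrow> (\<exists>j\<in>{1..n} - {k}. trop_le (u k * v k) (u j * v j)))"
proof -
  let ?f = "\<lambda>i. u i * v i"
  have "sum ?f {1..n} = sum ?f ({1..n} - {k}) \<longleftrightarrow>
      (?f k \<noteq> 0 \<longrightarrow> (\<exists>j\<in>{1..n} - {k}. trop_le (?f k) (?f j)))" if k: "k \<in> {1..n}" for k
  proof -
    let ?r = "sum ?f ({1..n} - {k})"
    have "sum ?f {1..n} = ?r \<longleftrightarrow> trop_le (?f k) ?r"
      unfolding trop_le_def using sum.remove[of "{1..n}" k ?f] k by simp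
    also have "\<dots> \<longleftrightarrow> (?f k \<noteq> 0 \<longrightarrow> (\<exists>j\<in>{1..n} - {k}. trop_le (?f k) (?f j)))"
    proof (intro iffI impI)
      assume le: "trop_le (?f k) ?r" and nz: "?f k \<noteq> 0"
      then have "{1..n} - {k} \<noteq> {}" by (metis sum.empty trop_le_zero_right)
      then obtain j where "j \<in> {1..n} - {k}" "?r = ?f j"
        using sum_selects[of "{1..n} - {k}" ?f] by blast
      with le show "\<exists>j\<in>{1..n} - {k}. trop_le (?f k) (?f j)" by auto
    next
      assume *: "?f k \<noteq> 0 \<longrightarrow> (\<exists>j\<in>{1..n} - {k}. trop_le (?f k) (?f j))"
      show "trop_le (?f k) ?r"
      proof (cases "?f k = 0")
        case True
        then show ?thesis by (simp add: trop_le_def)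
      next
        case False
        with * obtain j where j: "j \<in> {1..n} - {k}" "trop_le (?f k) (?f j)" by blast
        have "trop_le (?f j) ?r" by (rule trop_le_sum[OF _ j(1)]) simp
        with j(2) show ?thesis by (rule trop_le_trans)
      qed
    qed
    finally show ?thesis .
  qed
  then show ?thesis unfolding trop_orthogonal_def by simp
qed

lemma trop_orthogonal_dominated:
  fixes u v :: "nat \<Rightarrow> 'a::totally_ordered_idempotent_semifield"
  assumes "trop_orthogonal n u v" "k \<in> {1..n}" and nonzero: "u k \<noteq> 0" "v k \<noteq> 0"
  obtains j where "j \<in> {1..n}" "j \<noteq> k" "u j \<noteq> 0" "v j \<noteq> 0" "trop_le (u k * v k) (u j * v j)"
proof -
  have nz: "u k * v k \<noteq> 0" using nonzero by (simp add: semifield_mult_eq_zero_iff)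
  with assms(1,2) obtain j where j: "j \<in> {1..n} - {k}" "trop_le (u k * v k) (u j * v j)"
    unfolding trop_orthogonal_iff by blast
  moreover from j(2) nz have "u j * v j \<noteq> 0" by (auto simp: trop_le_zero_right)
  ultimately show ?thesis by (intro that[of j]) auto
qed


section \<open>Valuated circuits and cocircuits\<close>

definition circuit_vec :: "(nat set \<Rightarrow> 'a::zero) \<Rightarrow> nat set \<Rightarrow> nat \<Rightarrow> 'a"
  where "circuit_vec c J i = (if i \<in> J then c (J - {i}) else 0)"

definition cocircuit_vec :: "(nat set \<Rightarrow> 'a::zero) \<Rightarrow> nat set \<Rightarrow> nat \<Rightarrow> 'a"
  where "cocircuit_vec c B i = (if i \<in> B then 0 else c (insert i B))"

lemma card_exchange:
  assumes "finite I" "j \<in> I" "k \<notin> I"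
  shows "card (insert k (I - {j})) = card I"
proof -
  have "card (insert k (I - {j})) = Suc (card (I - {j}))" using assms by simp
  then show ?thesis using card_Suc_Diff1[OF assms(1,2)] by simp
qed

text \<open>
  Suppose the term \<open>i\<^sub>0\<close> of \<open>\<Sum>i. u i * v i\<close> is nonzero; another term of at least
  its size is needed. Call \<open>I\<close> a base if \<open>c I \<noteq> 0\<close>. The weight \<open>c I / (\<Prod>i\<in>I. u i)\<close> of a base,
  with \<open>1 / 0\<close> read as infinitely large, is changed by a one-element exchange in a way that
  both hypotheses control: orthogonality of \<open>u\<close> to the circuit of \<open>insert i\<^sub>0 I\<close> lets \<open>i\<^sub>0\<close> enter
  a base of maximal weight without loss, and orthogonality of \<open>v\<close> to the cocircuit of
  \<open>I - {i\<^sub>0}\<close> then replaces \<open>i\<^sub>0\<close> by some \<open>k\<close>. As the weight cannot have increased,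
  the \<open>k\<close>-th term is large enough.
\<close>

lemma orthogonal_of_circuits_cocircuits:
  fixes c :: "nat set \<Rightarrow> 'a::totally_ordered_idempotent_semifield"
  assumes I0: "I0 \<in> subsets_card n d" "c I0 \<noteq> 0"
    and u: "\<And>J. J \<in> subsets_card n (Suc d) \<Longrightarrow> trop_orthogonal n u (circuit_vec c J)"
    and v: "\<And>B. B \<subseteq> {1..n} \<Longrightarrow> card B + 1 = d \<Longrightarrow> trop_orthogonal n v (cocircuit_vec c B)"
  shows "trop_orthogonal n u v"
  unfolding trop_orthogonal_iff
proof (intro ballI impI)
  fix i0 assume i0: "i0 \<in> {1..n}" and "u i0 * v i0 \<noteq> 0"
  then have ui0: "u i0 \<noteq> 0" and vi0: "v i0 \<noteq> 0" by auto
  define bases where "bases = {I \<in> subsets_card n d. c I \<noteq> 0}"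
  have fin_bases: "finite bases" by (simp add: bases_def finite_subsets_card)
  have fin: "finite I" if "I \<in> bases" for I
    using that by (auto simp: bases_def intro: subsets_card_finite)
  have base_exchange: "insert k (I - {j}) \<in> bases"
    if "I \<in> bases" "j \<in> I" "k \<in> {1..n}" "k \<notin> I" "c (insert k (I - {j})) \<noteq> 0" for I j k
    using that card_exchange[OF fin[OF that(1)] that(2,4)]
    by (auto simp: bases_def subsets_card_def)
  (* The weight is maximised lexicographically: elements with u i = 0 are counted first, as
     each of them contributes an infinite factor. *)
  define zeros where "zeros I = card {i \<in> I. u i = 0}" for I
  (* Up to the constant factor given by the product of all nonzero u i, this is
     c I / prod u I over the support of u; the complement avoids division. *)
  define weight where "weight I = c I * (\<Prod>i\<in>{i \<in> {1..n} - I. u i \<noteq> 0}. u i)" for I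
  have weight_exchange: "\<exists>q. q \<noteq> 0 \<and> weight I = c I * (u k * q) \<and>
      weight (insert k (I - {j})) = c (insert k (I - {j})) * (u j * q)"
    if "I \<in> bases" "j \<in> I" "k \<in> {1..n}" "k \<notin> I" "u j \<noteq> 0" "u k \<noteq> 0" for I j k
  proof -
    let ?Q = "{i \<in> {1..n} - insert k I. u i \<noteq> 0}"
    have "j \<in> {1..n}" using that(1,2) by (auto simp: bases_def subsets_card_def)
    then have "{i \<in> {1..n} - I. u i \<noteq> 0} = insert k ?Q"
      "{i \<in> {1..n} - insert k (I - {j}). u i \<noteq> 0} = insert j ?Q"
      using that by auto
    moreover have "j \<notin> ?Q" "k \<notin> ?Q" "finite ?Q" using that(2) by auto
    moreover have "prod u ?Q \<noteq> 0" by (rule semifield_prod_nonzero) simp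
    ultimately show ?thesis unfolding weight_def by (intro exI[of _ "prod u ?Q"]) simp
  qed
  define r where "r = Max (zeros ` bases)"
  define best where "best = {I \<in> bases. zeros I = r}"
  have "bases \<noteq> {}" using I0 by (auto simp: bases_def)
  then have "r \<in> zeros ` bases" unfolding r_def using fin_bases by (intro Max_in) auto
  then have best_ne: "best \<noteq> {}" by (auto simp: best_def)
  have r_max: "zeros I \<le> r" if "I \<in> bases" for I
    unfolding r_def using that fin_bases by (intro Max_ge) auto
  have zeros_exchange: "zeros (insert k (I - {j})) = zeros I + (if u k = 0 then 1 else 0)"
    if "I \<in> bases" "j \<in> I" "k \<notin> I" "u j \<noteq> 0" for I j k
  proof -
    have "{i \<in> insert k (I - {j}). u i = 0} =
        (if u k = 0 then insert k {i \<in> I. u i = 0} else {i \<in> I. u i = 0})"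
      using that(4) by auto
    then show ?thesis using that fin[OF that(1)] by (simp add: zeros_def)
  qed
  define heaviest where "heaviest I \<longleftrightarrow> I \<in> best \<and> (\<forall>K\<in>best. trop_le (weight K) (weight I))" for I
  have fin_best: "finite best" using fin_bases by (simp add: best_def)
  then obtain I1 where I1: "heaviest I1"
    using sum_selects[of best weight] best_ne trop_le_sum[of best _ weight]
    unfolding heaviest_def by metis
  obtain I where I: "heaviest I" "i0 \<in> I"
  proof (cases "i0 \<in> I1")
    case True
    then show ?thesis using I1 that by blast
  next
    case False
    have I1b: "I1 \<in> bases" using I1 by (simp add: heaviest_def best_def)
    then have "c I1 \<noteq> 0" and J: "insert i0 I1 \<in> subsets_card n (Suc d)"
      using False i0 fin[OF I1b] by (auto simp: bases_def subsets_card_def)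
    then have c0: "circuit_vec c (insert i0 I1) i0 = c I1" "circuit_vec c (insert i0 I1) i0 \<noteq> 0"
      using False by (simp_all add: circuit_vec_def)
    obtain j where j: "j \<noteq> i0" and uj: "u j \<noteq> 0" and cj: "circuit_vec c (insert i0 I1) j \<noteq> 0"
      and le: "trop_le (u i0 * c I1) (u j * circuit_vec c (insert i0 I1) j)"
      using trop_orthogonal_dominated[OF u[OF J] i0 ui0 c0(2)] unfolding c0(1) by metis
    define I' where "I' = insert i0 (I1 - {j})"
    have jI1: "j \<in> I1" using cj j by (auto simp: circuit_vec_def split: if_splits)
    have cI': "circuit_vec c (insert i0 I1) j = c I'"
      using jI1 j by (simp add: circuit_vec_def I'_def insert_Diff_if)
    have "I' \<in> bases" "zeros I' = zeros I1"
      using base_exchange[OF I1b jI1 i0 False] zeros_exchange[OF I1b jI1 False uj] cj cI' ui0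
      by (auto simp: I'_def)
    then have I'b: "I' \<in> best" using I1 by (simp add: heaviest_def best_def)
    obtain q where "weight I1 = c I1 * (u i0 * q)" "weight I' = c I' * (u j * q)"
      using weight_exchange[OF I1b jI1 i0 False uj ui0] unfolding I'_def by blast
    with trop_le_mult_left[OF le, of q] have "trop_le (weight I1) (weight I')"
      by (simp add: cI' ac_simps)
    then have "heaviest I'"
      using I1 I'b unfolding heaviest_def by (blast intro: trop_le_trans)
    then show ?thesis by (rule that) (simp add: I'_def)
  qed
  have Ib: "I \<in> bases" using I by (simp add: heaviest_def best_def)
  define B where "B = I - {i0}"
  have cI: "c I \<noteq> 0" and IB: "insert i0 B = I" using Ib I by (auto simp: bases_def B_def)
  have "B \<subseteq> {1..n}" "card B + 1 = d"
    using Ib I(2) fin[OF Ib] card_Suc_Diff1[of I i0] by (auto simp: bases_def subsets_card_def B_def)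
  then have orth: "trop_orthogonal n v (cocircuit_vec c B)" by (rule v)
  have c0: "cocircuit_vec c B i0 = c I" "cocircuit_vec c B i0 \<noteq> 0"
    using cI IB by (simp_all add: cocircuit_vec_def B_def)
  obtain k where k: "k \<in> {1..n}" "k \<noteq> i0" and ck: "cocircuit_vec c B k \<noteq> 0"
    and le: "trop_le (v i0 * c I) (v k * cocircuit_vec c B k)"
    using trop_orthogonal_dominated[OF orth i0 vi0 c0(2)] unfolding c0(1) by metis
  from ck have kB: "k \<notin> B" and cI': "c (insert k B) \<noteq> 0"
    by (auto simp: cocircuit_vec_def split: if_splits)
  then have kI: "k \<notin> I" using k(2) by (simp add: B_def)
  have I'b: "insert k B \<in> bases"
    using base_exchange[OF Ib I(2) k(1) kI] cI' by (simp add: B_def)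
  have z: "zeros (insert k B) = zeros I + (if u k = 0 then 1 else 0)"
    using zeros_exchange[OF Ib I(2) kI ui0] by (simp add: B_def)
  have zI: "zeros I = r" using I by (simp add: heaviest_def best_def)
  have uk: "u k \<noteq> 0" using r_max[OF I'b] z zI by auto
  then have "insert k B \<in> best" using I'b z zI by (simp add: best_def)
  then have wle: "trop_le (weight (insert k B)) (weight I)" using I(1) by (simp add: heaviest_def)
  obtain q where q: "q \<noteq> 0" "weight I = c I * (u k * q)"
      "weight (insert k B) = c (insert k B) * (u i0 * q)"
    using weight_exchange[OF Ib I(2) k(1) kI ui0 uk] unfolding B_def by blast
  let ?z = "q * c (insert k B)"
  have "trop_le (?z * (u i0 * v i0)) (v i0 * weight I)"
    using trop_le_mult_left[OF wle, of "v i0"] by (simp add: q ac_simps)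
  moreover have "trop_le (v i0 * weight I) (?z * (u k * v k))"
    using trop_le_mult_left[OF le, of "u k * q"] kB by (simp add: q cocircuit_vec_def ac_simps)
  ultimately have "trop_le (?z * (u i0 * v i0)) (?z * (u k * v k))" by (rule trop_le_trans)
  moreover have "?z \<noteq> 0" using q(1) cI' by (simp add: semifield_mult_eq_zero_iff)
  ultimately have "trop_le (u i0 * v i0) (u k * v k)" by (rule trop_le_mult_left_cancel[rotated])
  with k show "\<exists>j\<in>{1..n} - {i0}. trop_le (u i0 * v i0) (u j * v j)" by blast
qed

text \<open>
  The product of a circuit and a cocircuit vanishes off \<open>J - B\<close>, and on \<open>J - B\<close> it has exactly
  the terms of a Pluecker relation; this makes cocircuits elements of \<open>L\<^sub>w\<close> and circuits
  elements of \<open>L\<close> of the Hodge star.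
\<close>

lemma plucker_cocircuit_circuit_orthogonal:
  assumes "plucker_vector n d w" and J: "J \<in> subsets_card n (Suc d)"
    and B: "B \<subseteq> {1..n}" "card B + 1 = d"
  shows "trop_orthogonal n (cocircuit_vec (gcoeff n d w) B) (circuit_vec (gcoeff n d w) J)"
proof -
  let ?c = "gcoeff n d w"
  let ?f = "\<lambda>i. cocircuit_vec ?c B i * circuit_vec ?c J i"
  let ?g = "\<lambda>i. ?c (J - {i}) * ?c (insert i B)"
  have J': "J \<subseteq> {1..n}" "card J = d + 1" using J by (auto simp: subsets_card_def)
  have restrict: "sum ?f ({1..n} - K) = sum ?g (J - B - K)" for K
    using J' by (intro sum.mono_neutral_cong_right)
      (auto simp: cocircuit_vec_def circuit_vec_def mult.commute)
  show ?thesis unfolding trop_orthogonal_def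
  proof
    fix k assume "k \<in> {1..n}"
    show "sum ?f {1..n} = sum ?f ({1..n} - {k})"
    proof (cases "k \<in> J - B")
      case True
      then show ?thesis using assms(1) J' B restrict[of "{}"] restrict[of "{k}"]
        unfolding plucker_vector_def by simp
    next
      case False
      then show ?thesis using restrict[of "{}"] restrict[of "{k}"] by simp
    qed
  qed
qed


section \<open>Coefficients in the tropical Grassmann algebra\<close>

lemma gcoeff_spec:
  assumes "w \<in> grassmann_deg n d"
  shows "w = gcomb n d (gcoeff n d w)"
  using theI'[OF grassmann_deg_free[OF assms]] unfolding gcoeff_def by blast

lemma gcomb_nonzero_coeff:
  assumes "gcomb n d c \<noteq> gclass n 0"
  shows "\<exists>I\<in>subsets_card n d. c I \<noteq> 0"
proof (rule ccontr)
  assume "\<not> ?thesis"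
  then have "gpoly n d c = 0" unfolding gpoly_def by (intro sum.neutral) (simp add: Const_def)
  with assms show False by (simp add: gcomb_gpoly)
qed

definition mono_degree :: "(nat \<Rightarrow>\<^sub>0 nat) \<Rightarrow> nat"
  where "mono_degree m = (\<Sum>i\<in>Poly_Mapping.keys m. Poly_Mapping.lookup m i)"

lemma mono_degree_add: "mono_degree (k + l) = mono_degree k + mono_degree l"
proof -
  let ?K = "Poly_Mapping.keys k \<union> Poly_Mapping.keys l"
  have "mono_degree m = (\<Sum>i\<in>?K. Poly_Mapping.lookup m i)" if "Poly_Mapping.keys m \<subseteq> ?K" for m
    unfolding mono_degree_def using that by (intro sum.mono_neutral_left) (auto simp: in_keys_iff)
  then show ?thesis using keys_add[of k l] by (simp add: lookup_add sum.distrib)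
qed

lemma Sym_deg_mult:
  assumes "p \<in> Sym_deg n d" "q \<in> Sym_deg n d'"
  shows "p * q \<in> Sym_deg n (d + d')"
proof -
  have "mono_degree m = d + d'" if "m \<in> Poly_Mapping.keys (p * q)" for m
  proof -
    from that keys_mult[of p q] obtain k l where
      "m = k + l" "k \<in> Poly_Mapping.keys p" "l \<in> Poly_Mapping.keys q" by auto
    moreover from this assms have "mono_degree k = d" "mono_degree l = d'"
      by (auto simp: Sym_deg_def mono_degree_def)
    ultimately show ?thesis by (simp add: mono_degree_add)
  qed
  with assms show ?thesis by (simp add: Sym_deg_def Sym_mult mono_degree_def)
qed

text \<open>Each class of degree \<open>d\<close> has a unique square-free representative.\<close>

lemma gclass_eq_iff_lookup:
  assumes p: "p \<in> Sym_deg n d" and q: "q \<in> Sym_deg n d"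
  shows "gclass n p = gclass n q \<longleftrightarrow> (\<forall>J\<in>subsets_card n d.
    Poly_Mapping.lookup p (mono_of J) = Poly_Mapping.lookup q (mono_of J))"
proof -
  have Sym: "p \<in> Sym n" "q \<in> Sym n" using p q by (simp_all add: Sym_deg_def)
  show ?thesis unfolding gclass_eq_iff[OF Sym]
  proof
    assume "(p, q) \<in> gcong n"
    then show "\<forall>J\<in>subsets_card n d.
        Poly_Mapping.lookup p (mono_of J) = Poly_Mapping.lookup q (mono_of J)"
      by (intro ballI gcong_lookup) (auto simp: lookup_mono_of subsets_card_finite)
  next
    assume *: "\<forall>J\<in>subsets_card n d.
        Poly_Mapping.lookup p (mono_of J) = Poly_Mapping.lookup q (mono_of J)"
    have "gpoly n d (\<lambda>I. Poly_Mapping.lookup p (mono_of I)) =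
        gpoly n d (\<lambda>I. Poly_Mapping.lookup q (mono_of I))"
      unfolding gpoly_def using * by (intro sum.cong) auto
    then show "(p, q) \<in> gcong n"
      using gcong_gpoly[OF p] gcong_gpoly[OF q] by (metis gcong.sym gcong.trans)
  qed
qed

definition linear_form :: "nat \<Rightarrow> (nat \<Rightarrow> 'a::comm_semiring_1) \<Rightarrow> 'a sympoly"
  where "linear_form n v = (\<Sum>i\<in>{1..n}. Const (v i) * X i)"

lemma Const_mult_X: "Const a * X i = Poly_Mapping.single (Poly_Mapping.single i 1) a"
  by (simp add: Const_def X_def mult_single)

lemma linear_form_in_Sym_deg: "linear_form n v \<in> Sym_deg n 1"
proof -
  have "\<exists>i\<in>{1..n}. m = Poly_Mapping.single i 1" if "m \<in> Poly_Mapping.keys (linear_form n v)" for m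
  proof (rule ccontr)
    assume "\<not> ?thesis"
    then have "Poly_Mapping.lookup (linear_form n v) m = 0"
      unfolding linear_form_def lookup_sum Const_mult_X
      by (intro sum.neutral) (auto simp: lookup_single when_def)
    with that show False by (simp add: in_keys_iff)
  qed
  then show ?thesis by (force simp: Sym_deg_def Sym_def)
qed

lemma single_add_mono_of_eq_iff:
  assumes "finite I" "finite J"
  shows "Poly_Mapping.single i 1 + mono_of I = mono_of J \<longleftrightarrow> i \<in> J \<and> I = J - {i}"
proof
  assume eq: "Poly_Mapping.single i 1 + mono_of I = mono_of J"
  have look: "(if k = i then 1 else 0) + (if k \<in> I then 1 else 0) = (if k \<in> J then 1 else (0::nat))"
    for k using arg_cong[OF eq, of "\<lambda>m. Poly_Mapping.lookup m k"] assms
    by (simp add: lookup_add lookup_mono_of lookup_single when_def eq_commute)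
  have "i \<in> J \<and> i \<notin> I" using look[of i] by (auto split: if_splits)
  moreover from this have "k \<in> I \<longleftrightarrow> k \<in> J - {i}" for k
    using look[of k] by (cases "k = i") (auto split: if_splits)
  ultimately show "i \<in> J \<and> I = J - {i}" by blast
next
  assume "i \<in> J \<and> I = J - {i}"
  with assms show "Poly_Mapping.single i 1 + mono_of I = mono_of J"
    by (intro poly_mapping_eqI) (auto simp: lookup_add lookup_mono_of lookup_single when_def)
qed

text \<open>
  A monomial \<open>J\<close> arises from \<open>i\<close> and \<open>I\<close> only for \<open>i \<in> J\<close> and \<open>I = J - {i}\<close>, which is why the
  circuits of \<open>c\<close> appear; this turns membership in \<open>L\<^sub>w\<close> into orthogonality to circuits.
\<close>

lemma lookup_linear_form_mult_gpoly:
  assumes J: "J \<in> subsets_card n (Suc d)"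
  shows "Poly_Mapping.lookup (linear_form n v * gpoly n d c) (mono_of J) =
    (\<Sum>i\<in>{1..n}. v i * circuit_vec c J i)"
proof -
  let ?D = "subsets_card n d"
  have "linear_form n v * gpoly n d c = (\<Sum>i\<in>{1..n}. \<Sum>I\<in>?D.
      Poly_Mapping.single (Poly_Mapping.single i 1 + mono_of I) (v i * c I))"
    unfolding linear_form_def gpoly_def sum_product Const_mult_X
    by (intro sum.cong HOL.refl) (simp add: Const_prod_X subsets_card_finite mult_single)
  then have "Poly_Mapping.lookup (linear_form n v * gpoly n d c) (mono_of J) =
      (\<Sum>i\<in>{1..n}. \<Sum>I\<in>?D. if I = J - {i} then (if i \<in> J then v i * c I else 0) else 0)"
    using J by (auto simp: lookup_sum lookup_single when_def single_add_mono_of_eq_iff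
        subsets_card_finite simp del: One_nat_def intro!: sum.cong)
  also have "\<dots> = (\<Sum>i\<in>{1..n}. v i * circuit_vec c J i)"
  proof (intro sum.cong HOL.refl)
    fix i
    have "J - {i} \<in> ?D" if "i \<in> J" using that J by (auto simp: subsets_card_def)
    then show "(\<Sum>I\<in>?D. if I = J - {i} then (if i \<in> J then v i * c I else 0) else 0) =
        v i * circuit_vec c J i"
      by (auto simp: finite_subsets_card circuit_vec_def)
  qed
  finally show ?thesis .
qed

lemma wedge_linear_form_eq_iff:
  "wedge n (gclass n (linear_form n u)) (gcomb n d c) =
      wedge n (gclass n (linear_form n v)) (gcomb n d c) \<longleftrightarrow>
    (\<forall>J\<in>subsets_card n (Suc d).
      (\<Sum>i\<in>{1..n}. u i * circuit_vec c J i) = (\<Sum>i\<in>{1..n}. v i * circuit_vec c J i))"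
proof -
  have deg: "linear_form n v * gpoly n d c \<in> Sym_deg n (Suc d)" for v
    using Sym_deg_mult[OF linear_form_in_Sym_deg gpoly_in_Sym_deg, of n v d c] by simp
  have "wedge n (gclass n (linear_form n v)) (gcomb n d c) =
      gclass n (linear_form n v * gpoly n d c)" for v
    using linear_form_in_Sym_deg[of n v] gpoly_in_Sym_deg[of n d c]
    by (simp add: gcomb_gpoly wedge_gclass Sym_deg_def)
  then show ?thesis
    by (simp add: gclass_eq_iff_lookup[OF deg deg] lookup_linear_form_mult_gpoly)
qed

lemma hodge_star_eq_gcomb:
  assumes "d \<le> n"
  shows "hodge_star n d w = gcomb n (n - d) (\<lambda>K. gcoeff n d w ({1..n} - K))"
proof -
  let ?compl = "\<lambda>I. {1..n} - I"
  have "(\<Sum>I\<in>subsets_card n d. Const (gcoeff n d w I) * (\<Prod>i\<in>?compl I. X i)) =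
      (\<Sum>K\<in>subsets_card n (n - d). Const (gcoeff n d w (?compl K)) * (\<Prod>i\<in>K. X i))"
    using assms
    by (intro sum.reindex_bij_witness[of _ ?compl ?compl])
      (auto simp: subsets_card_def double_diff card_Diff_subset finite_subset)
  then show ?thesis by (simp add: hodge_star_def gcomb_def)
qed

text \<open>
  If \<open>K\<close> is the complement of \<open>B\<close>, then the complement of \<open>K - {i}\<close> is \<open>insert i B\<close>, so the
  circuits of the Hodge star are the cocircuits of the original vector.
\<close>

lemma circuits_of_hodge_star:
  assumes "d \<le> n"
  shows "(\<forall>K\<in>subsets_card n (Suc (n - d)).
      trop_orthogonal n v (circuit_vec (\<lambda>K. c ({1..n} - K)) K)) \<longleftrightarrow>
    (\<forall>B. B \<subseteq> {1..n} \<longrightarrow> card B + 1 = d \<longrightarrow> trop_orthogonal n v (cocircuit_vec c B))"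
proof -
  have dual: "trop_orthogonal n v (circuit_vec (\<lambda>K. c ({1..n} - K)) ({1..n} - B)) \<longleftrightarrow>
      trop_orthogonal n v (cocircuit_vec c B)" if "B \<subseteq> {1..n}" for B
  proof (rule trop_orthogonal_cong)
    fix i assume "i \<in> {1..n}"
    moreover from this that have "{1..n} - ({1..n} - B - {i}) = insert i B" by auto
    ultimately show "circuit_vec (\<lambda>K. c ({1..n} - K)) ({1..n} - B) i = cocircuit_vec c B i"
      by (simp add: circuit_vec_def cocircuit_vec_def)
  qed simp
  have card: "card ({1..n} - B) = n - card B" "card B \<le> n" if "B \<subseteq> {1..n}" for B
    using that card_mono[OF _ that] by (auto simp: card_Diff_subset finite_subset)
  show ?thesis
  proof (intro iffI ballI allI impI)
    fix B assume *: "\<forall>K\<in>subsets_card n (Suc (n - d)).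
        trop_orthogonal n v (circuit_vec (\<lambda>K. c ({1..n} - K)) K)"
      and B: "B \<subseteq> {1..n}" "card B + 1 = d"
    have "{1..n} - B \<in> subsets_card n (Suc (n - d))"
      using B card[OF B(1)] assms by (auto simp: subsets_card_def)
    with * dual[OF B(1)] show "trop_orthogonal n v (cocircuit_vec c B)" by blast
  next
    fix K assume *: "\<forall>B. B \<subseteq> {1..n} \<longrightarrow> card B + 1 = d \<longrightarrow>
        trop_orthogonal n v (cocircuit_vec c B)"
      and K: "K \<in> subsets_card n (Suc (n - d))"
    have "K \<subseteq> {1..n}" "card K = Suc (n - d)" using K by (auto simp: subsets_card_def)
    moreover from this have "card ({1..n} - K) + 1 = d" using card[of K] assms by simp
    moreover from calculation have "{1..n} - ({1..n} - K) = K" by auto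
    ultimately show "trop_orthogonal n v (circuit_vec (\<lambda>K. c ({1..n} - K)) K)"
      using * dual[of "{1..n} - K"] by auto
  qed
qed


section \<open>Tropical kernels in coordinates\<close>

text \<open>
  A common framework for \<open>V\<close> and its dual. The carrier \<open>F\<close> is needed for the dual, since its
  ambient type contains all functions and not just the linear ones.
\<close>

locale based_semimodule = semimodule sm
  for sm :: "'a::comm_semiring_1 \<Rightarrow> 'f::comm_monoid_add \<Rightarrow> 'f" +
  fixes F :: "'f set" and n :: nat and f :: "nat \<Rightarrow> 'f"
  assumes is_basis: "is_basis sm F n f"
    and lincomb_closed: "lincomb sm f {1..n} v \<in> F"
begin

lemma coords_props:
  assumes "u \<in> F"
  shows "u = lincomb sm f {1..n} (coords sm n f u)"
    and "\<And>v. (\<And>i. i \<notin> {1..n} \<Longrightarrow> v i = 0) \<Longrightarrow> u = lincomb sm f {1..n} v \<Longrightarrow> coords sm n f u = v"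
proof -
  have ex1: "\<exists>!v. (\<forall>i. i \<notin> {1..n} \<longrightarrow> v i = 0) \<and> u = lincomb sm f {1..n} v"
    using is_basis assms unfolding is_basis_def by blast
  show "u = lincomb sm f {1..n} (coords sm n f u)"
    unfolding coords_def by (rule conjunct2[OF theI'[OF ex1]])
  show "coords sm n f u = v"
    if "\<And>i. i \<notin> {1..n} \<Longrightarrow> v i = 0" "u = lincomb sm f {1..n} v" for v
    unfolding coords_def using ex1 by (rule the1_equality) (intro conjI allI impI that)
qed

lemma coords_of_lincomb:
  assumes "i \<in> {1..n}"
  shows "coords sm n f (lincomb sm f {1..n} v) i = v i"
proof -
  let ?v = "\<lambda>i. if i \<in> {1..n} then v i else 0"
  have "lincomb sm f {1..n} v = lincomb sm f {1..n} ?v"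
    unfolding lincomb_def by (intro sum.cong) auto
  then have "coords sm n f (lincomb sm f {1..n} v) = ?v"
    by (intro coords_props(2)[OF lincomb_closed]) auto
  then show ?thesis using assms by simp
qed

lemma lincomb_delete:
  "lincomb sm f ({1..n} - {j}) v = lincomb sm f {1..n} (v(j := 0))"
  unfolding lincomb_def
  by (intro sum.mono_neutral_cong_left) (auto simp: scale_zero_left)

lemma tropker_iff:
  "u \<in> tropker sm n f \<phi> \<longleftrightarrow> u \<in> F \<and> (\<forall>j\<in>{1..n}.
    \<phi> (lincomb sm f {1..n} (coords sm n f u)) = \<phi> (lincomb sm f ({1..n} - {j}) (coords sm n f u)))"
    (is "_ \<longleftrightarrow> _ \<and> ?K u")
proof
  assume "u \<in> tropker sm n f \<phi>"
  then obtain v where v: "u = lincomb sm f {1..n} v"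
    "\<forall>j\<in>{1..n}. \<phi> (lincomb sm f {1..n} v) = \<phi> (lincomb sm f ({1..n} - {j}) v)"
    unfolding tropker_def by blast
  have "lincomb sm f K (coords sm n f u) = lincomb sm f K v" if "K \<subseteq> {1..n}" for K
    unfolding lincomb_def using that by (intro sum.cong) (auto simp: v(1) coords_of_lincomb simp del: One_nat_def)
  then have "?K u" using v(2) by simp
  then show "u \<in> F \<and> ?K u" using lincomb_closed v(1) by simp
next
  assume "u \<in> F \<and> ?K u"
  then show "u \<in> tropker sm n f \<phi>"
    unfolding tropker_def using coords_props(1)[of u] by blast
qed

lemma gincl_lincomb: "gincl sm n f (lincomb sm f {1..n} v) = gclass n (linear_form n v)"
  unfolding gincl_def linear_form_def by (simp add: coords_of_lincomb del: One_nat_def)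

lemma L_mod_iff:
  "u \<in> L_mod sm n f (gcomb n d c) \<longleftrightarrow>
    u \<in> F \<and> (\<forall>J\<in>subsets_card n (Suc d). trop_orthogonal n (coords sm n f u) (circuit_vec c J))"
proof -
  have "(\<Sum>i\<in>{1..n}. (v(j := 0)) i * g i) = (\<Sum>i\<in>{1..n} - {j}. v i * g i)"
    for v :: "nat \<Rightarrow> 'a" and g j
    by (intro sum.mono_neutral_cong_right) auto
  then show ?thesis
    unfolding L_mod_def tropker_iff lincomb_delete gincl_lincomb wedge_linear_form_eq_iff
      trop_orthogonal_def by auto
qed

end

context free_semimodule
begin

sublocale primal: based_semimodule scale UNIV n e
  by unfold_locales (auto intro: basis)

lemma lincomb_dual_in_dual_space:
  "lincomb dual_scale (dual_basis scale n e) {1..n} v \<in> dual_space scale"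
  by (simp add: dual_space_def lincomb_apply dual_basis_def coords_add coords_scale
      distrib_left sum.distrib sum_distrib_left ac_simps)

sublocale dual: based_semimodule dual_scale "dual_space scale" n "dual_basis scale n e"
  by unfold_locales (simp_all add: dual_scale_def fun_eq_iff algebra_simps
      dual_basis_is_basis lincomb_dual_in_dual_space del: One_nat_def)

lemma orth_iff:
  "\<xi> \<in> orth scale n e L \<longleftrightarrow> (\<forall>\<alpha>\<in>L. \<xi> \<in> dual_space scale \<and>
    trop_orthogonal n (coords dual_scale n (dual_basis scale n e) \<xi>) (coords scale n e \<alpha>))"
  unfolding orth_def dual.tropker_iff INT_iff
  by (simp add: lincomb_apply trop_orthogonal_def dual_basis_def)

lemma dual_coords:
  assumes "\<xi> \<in> dual_space scale" "i \<in> {1..n}"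
  shows "\<xi> (e i) = coords dual_scale n (dual_basis scale n e) \<xi> i"
proof -
  let ?c = "coords dual_scale n (dual_basis scale n e) \<xi>"
  have "\<xi> (e i) = lincomb dual_scale (dual_basis scale n e) {1..n} ?c (e i)"
    by (subst dual.coords_props(1)[OF assms(1)]) (rule HOL.refl)
  also have "\<dots> = (\<Sum>k\<in>{1..n}. if k = i then ?c k else 0)"
    unfolding lincomb_apply[OF finite_atLeastAtMost]
    using assms(2) by (intro sum.cong HOL.refl) (simp add: dual_basis_apply)
  finally show ?thesis using assms(2) by simp
qed

lemma orth_dual_iff:
  assumes "M \<subseteq> dual_space scale"
  shows "\<alpha> \<in> orth_dual scale n e M \<longleftrightarrow> (\<forall>\<xi>\<in>M.
    trop_orthogonal n (coords scale n e \<alpha>) (coords dual_scale n (dual_basis scale n e) \<xi>))"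
proof -
  have "\<xi> (lincomb scale e K c) =
      (\<Sum>i\<in>K. c i * coords dual_scale n (dual_basis scale n e) \<xi> i)"
    if "\<xi> \<in> M" "K \<subseteq> {1..n}" for \<xi> K c
  proof -
    have \<xi>: "\<xi> \<in> dual_space scale" and K: "finite K"
      using that assms by (auto intro: finite_subset)
    show ?thesis unfolding lincomb_def dual_space_sum[OF \<xi> K]
      using that(2) by (intro sum.cong HOL.refl) (auto simp: dual_coords[OF \<xi>])
  qed
  then show ?thesis
    unfolding orth_dual_def primal.tropker_iff INT_iff trop_orthogonal_def by simp
qed

end


section \<open>Duality\<close>

theorem corollary4p4p4:
  fixes scale :: "'a::totally_ordered_idempotent_semifield \<Rightarrow> 'v::comm_monoid_add \<Rightarrow> 'v"
    and e :: "nat \<Rightarrow> 'v" and n d :: nat and w :: "'a sympoly set"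
  assumes "free_semimodule scale n e"
    and "w \<in> grassmann_deg n d"
    and "plucker_vector n d w"
  shows "orth scale n e (L_mod scale n e w) =
           L_mod dual_scale n (dual_basis scale n e) (hodge_star n d w)
         \<and> orth_dual scale n e (orth scale n e (L_mod scale n e w)) = L_mod scale n e w"
proof -
  interpret free_semimodule scale n e by fact
  let ?x = "dual_basis scale n e"
  let ?P = "coords scale n e" and ?D = "coords dual_scale n ?x"
  define c where "c = gcoeff n d w"
  let ?circuits = "\<lambda>u. \<forall>J\<in>subsets_card n (Suc d). trop_orthogonal n u (circuit_vec c J)"
  let ?cocircuits = "\<lambda>u. \<forall>B. B \<subseteq> {1..n} \<longrightarrow> card B + 1 = d \<longrightarrow> trop_orthogonal n u (cocircuit_vec c B)"
  have w: "w = gcomb n d c" unfolding c_def by (rule gcoeff_spec[OF assms(2)])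
  moreover have "w \<noteq> gclass n 0" using assms(3) by (simp add: plucker_vector_def)
  ultimately obtain I0 where I0: "I0 \<in> subsets_card n d" "c I0 \<noteq> 0"
    using gcomb_nonzero_coeff by blast
  then have dn: "d \<le> n" using card_mono[of "{1..n}" I0] by (auto simp: subsets_card_def)
  have L: "\<alpha> \<in> L_mod scale n e w \<longleftrightarrow> ?circuits (?P \<alpha>)" for \<alpha>
    unfolding w primal.L_mod_iff by simp
  have L_star: "\<xi> \<in> L_mod dual_scale n ?x (hodge_star n d w) \<longleftrightarrow>
      \<xi> \<in> dual_space scale \<and> ?cocircuits (?D \<xi>)" for \<xi>
    unfolding hodge_star_eq_gcomb[OF dn] dual.L_mod_iff c_def[symmetric]
      circuits_of_hodge_star[OF dn] ..
  have orthogonal: "trop_orthogonal n u v" if "?circuits u" "?cocircuits v" for u v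
    by (rule orthogonal_of_circuits_cocircuits[where c = c, OF I0]) (simp_all only: that)
  have plucker: "trop_orthogonal n (cocircuit_vec c B) (circuit_vec c J)"
    if "J \<in> subsets_card n (Suc d)" "B \<subseteq> {1..n}" "card B + 1 = d" for J B
    unfolding c_def using assms(3) that by (rule plucker_cocircuit_circuit_orthogonal)
  have P_lincomb: "trop_orthogonal n (?P (lincomb scale e {1..n} v)) u \<longleftrightarrow> trop_orthogonal n v u"
    for u v by (rule trop_orthogonal_cong) (simp_all add: primal.coords_of_lincomb del: One_nat_def)
  have D_lincomb: "trop_orthogonal n (?D (lincomb dual_scale ?x {1..n} v)) u \<longleftrightarrow>
      trop_orthogonal n v u"
    for u v by (rule trop_orthogonal_cong) (simp_all add: dual.coords_of_lincomb del: One_nat_def)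
  have first: "orth scale n e (L_mod scale n e w) = L_mod dual_scale n ?x (hodge_star n d w)"
  proof (intro set_eqI iffI)
    fix \<xi> assume "\<xi> \<in> orth scale n e (L_mod scale n e w)"
    then have perp: "\<xi> \<in> dual_space scale \<and> trop_orthogonal n (?D \<xi>) (?P \<alpha>)"
      if "?circuits (?P \<alpha>)" for \<alpha>
      using that by (simp add: orth_iff L)
    (* The carrier of the dual is only enforced because L contains 0. *)
    have "?circuits (?P (lincomb scale e {1..n} (\<lambda>_. 0)))"
      unfolding P_lincomb by (simp add: trop_orthogonal_def)
    then have "\<xi> \<in> dual_space scale" using perp by blast
    moreover have "?cocircuits (?D \<xi>)"
    proof (intro allI impI)
      fix B assume B: "B \<subseteq> {1..n}" "card B + 1 = d"
      let ?\<alpha> = "lincomb scale e {1..n} (cocircuit_vec c B)"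
      have "?circuits (?P ?\<alpha>)" unfolding P_lincomb using plucker B by simp
      from conjunct2[OF perp[OF this]] have "trop_orthogonal n (?P ?\<alpha>) (?D \<xi>)"
        by (simp only: trop_orthogonal_commute)
      then show "trop_orthogonal n (?D \<xi>) (cocircuit_vec c B)"
        unfolding P_lincomb by (simp add: trop_orthogonal_commute)
    qed
    ultimately show "\<xi> \<in> L_mod dual_scale n ?x (hodge_star n d w)" by (simp add: L_star)
  next
    fix \<xi> assume "\<xi> \<in> L_mod dual_scale n ?x (hodge_star n d w)"
    then have \<xi>: "\<xi> \<in> dual_space scale" and cocircuits: "?cocircuits (?D \<xi>)"
      unfolding L_star by blast+
    have "trop_orthogonal n (?D \<xi>) (?P \<alpha>)" if "\<alpha> \<in> L_mod scale n e w" for \<alpha>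
      using orthogonal[OF that[unfolded L] cocircuits] by (simp only: trop_orthogonal_commute)
    with \<xi> show "\<xi> \<in> orth scale n e (L_mod scale n e w)" by (simp add: orth_iff)
  qed
  have second: "orth_dual scale n e (L_mod dual_scale n ?x (hodge_star n d w)) = L_mod scale n e w"
  proof (intro set_eqI)
    fix \<alpha>
    have "L_mod dual_scale n ?x (hodge_star n d w) \<subseteq> dual_space scale"
      using L_star by blast
    then have *: "\<alpha> \<in> orth_dual scale n e (L_mod dual_scale n ?x (hodge_star n d w)) \<longleftrightarrow>
        (\<forall>\<xi>. \<xi> \<in> dual_space scale \<and> ?cocircuits (?D \<xi>) \<longrightarrow> trop_orthogonal n (?P \<alpha>) (?D \<xi>))"
      using L_star by (simp only: orth_dual_iff Ball_def)
    show "\<alpha> \<in> orth_dual scale n e (L_mod dual_scale n ?x (hodge_star n d w)) \<longleftrightarrow>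
        \<alpha> \<in> L_mod scale n e w"
      unfolding * L
    proof (intro iffI ballI allI impI)
      fix J assume perp: "\<forall>\<xi>. \<xi> \<in> dual_space scale \<and> ?cocircuits (?D \<xi>) \<longrightarrow>
          trop_orthogonal n (?P \<alpha>) (?D \<xi>)" and J: "J \<in> subsets_card n (Suc d)"
      let ?\<xi> = "lincomb dual_scale ?x {1..n} (circuit_vec c J)"
      have "?cocircuits (?D ?\<xi>)"
        unfolding D_lincomb trop_orthogonal_commute[of n "circuit_vec c J"] using plucker[OF J] by simp
      with perp dual.lincomb_closed have "trop_orthogonal n (?P \<alpha>) (?D ?\<xi>)" by simp
      then have "trop_orthogonal n (?D ?\<xi>) (?P \<alpha>)" by (simp only: trop_orthogonal_commute)
      then show "trop_orthogonal n (?P \<alpha>) (circuit_vec c J)"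
        unfolding D_lincomb by (simp add: trop_orthogonal_commute)
    next
      fix \<xi> assume "?circuits (?P \<alpha>)" and \<xi>: "\<xi> \<in> dual_space scale \<and> ?cocircuits (?D \<xi>)"
      from this(1) conjunct2[OF \<xi>] show "trop_orthogonal n (?P \<alpha>) (?D \<xi>)" by (rule orthogonal)
    qed
  qed
  show ?thesis using first second by simp
qed

end
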